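(* For every positive integer $n$, the $n\times n$ Stirling matrix of second kind $\mathcal S$ is triangular totally positive.
   Context: Let $(x)_0=1$ and $(x)_k=x(x-1)\cdots(x-k+1)$ for a positive integer $k$. The Stirling numbers of second kind $S(n,k)$ are defined by $x^n=\sum_{k=0}^{n}S(n,k)(x)_k$. The $n\times n$ Stirling matrix of second kind $\mathcal S=[\mathcal S_{ij}]_{i,j=1}^{n}$ is defined by $\mathcal S_{ij}=S(i,j)$ if $i\ge j$ and $\mathcal S_{ij}=0$ otherwise. A lower triangular $n\times n$ matrix $A$ is called triangular totally positive if all its minors are positive except those that are zero by virtue of the lower triangular shape; that is, $\det A[\alpha,\gamma]>0$ for all $1\le p\le n$ and all $\alpha=\{\alpha_1<\cdots<\alpha_p\}$, $\gamma=\{\gamma_1<\cdots<\gamma_p\}$ contained in $\{1,\ldots,n\}$ with $\alpha_i\ge\gamma_i$ for all $i$, where $A[\alpha,\gamma]$ is the submatrix of $A$ with rows $\alpha_1,\ldots,\alpha_p$ and columns $\gamma_1,\ldots,\gamma_p$. *)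

theory Defs
  imports
    "HOL-Combinatorics.Stirling"
    "Jordan_Normal_Form.Determinant"
    "Jordan_Normal_Form.DL_Submatrix"
begin

definition falling_fact :: "real \<Rightarrow> nat \<Rightarrow> real" where
  "falling_fact x k = (\<Prod>i<k. x - real i)"

lemma falling_fact_Suc: "falling_fact x (Suc k) = falling_fact x k * (x - real k)"
  by (simp add: falling_fact_def)

lemma power_eq_sum_Stirling:
  "x ^ n = (\<Sum>k\<le>n. real (Stirling n k) * falling_fact x k)"
proof (induction n)
  case 0
  show ?case by (simp add: falling_fact_def)
next
  case (Suc n)
  let ?S = "\<lambda>n k. real (Stirling n k)"
  have "(\<Sum>k\<le>Suc n. ?S (Suc n) k * falling_fact x k)
      = (\<Sum>k\<le>n. ?S (Suc n) (Suc k) * falling_fact x (Suc k))"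
    by (subst sum.atMost_Suc_shift) simp
  also have "\<dots> = (\<Sum>k\<le>n. real (Suc k) * ?S n (Suc k) * falling_fact x (Suc k))
      + (\<Sum>k\<le>n. ?S n k * falling_fact x (Suc k))"
    by (simp add: sum.distrib[symmetric] algebra_simps)
  also have "(\<Sum>k\<le>n. real (Suc k) * ?S n (Suc k) * falling_fact x (Suc k))
      = (\<Sum>k\<le>Suc n. real k * ?S n k * falling_fact x k)"
    by (subst sum.atMost_Suc_shift) simp
  also have "\<dots> = (\<Sum>k\<le>n. real k * ?S n k * falling_fact x k)"
    by simp
  also have "\<dots> + (\<Sum>k\<le>n. ?S n k * falling_fact x (Suc k))
      = x * (\<Sum>k\<le>n. ?S n k * falling_fact x k)"
    by (simp add: sum.distrib[symmetric] sum_distrib_left falling_fact_Suc algebra_simps)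
  finally show ?case using Suc.IH by simp
qed

lemma falling_fact_nat_eq_0: "m < k \<Longrightarrow> falling_fact (real m) k = 0"
  unfolding falling_fact_def by (rule prod_zero) auto

lemma falling_fact_nat_same: "falling_fact (real m) m \<noteq> 0"
  by (auto simp: falling_fact_def)

text \<open>
  The library defines the Stirling numbers of the second kind by their recurrence. The following
  lemma shows that they are exactly the coefficients in the expansion of \<open>x ^ n\<close> in
  falling factorials.
\<close>

lemma Stirling_iff_power_eq_sum:
  fixes c :: "nat \<Rightarrow> real"
  shows "(\<forall>x. x ^ n = (\<Sum>k\<le>n. c k * falling_fact x k)) \<longleftrightarrow> (\<forall>k\<le>n. c k = real (Stirling n k))"
proof
  assume L: "\<forall>x. x ^ n = (\<Sum>k\<le>n. c k * falling_fact x k)"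
  define d where "d k = c k - real (Stirling n k)" for k
  have d: "(\<Sum>k\<le>n. d k * falling_fact x k) = 0" for x
    using L[rule_format, of x] power_eq_sum_Stirling[of x n]
    by (simp add: d_def left_diff_distrib sum_subtractf)
  have "m \<le> n \<longrightarrow> d m = 0" for m
  proof (induction m rule: less_induct)
    case (less m)
    show ?case
    proof
      assume "m \<le> n"
      have "0 = (\<Sum>k\<le>n. d k * falling_fact (real m) k)"
        using d by simp
      also have "\<dots> = (\<Sum>k\<le>n. if k = m then d m * falling_fact (real m) m else 0)"
      proof (rule sum.cong)
        fix k assume k: "k \<in> {..n}"
        consider "k < m" | "k = m" | "m < k" by linarith
        then show "d k * falling_fact (real m) k =
            (if k = m then d m * falling_fact (real m) m else 0)"
          by cases (use less.IH k in \<open>auto simp: falling_fact_nat_eq_0\<close>)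
      qed simp
      also have "\<dots> = d m * falling_fact (real m) m"
        using \<open>m \<le> n\<close> by simp
      finally show "d m = 0" using falling_fact_nat_same[of m] by simp
    qed
  qed
  then show "\<forall>k\<le>n. c k = real (Stirling n k)" by (simp add: d_def)
next
  assume "\<forall>k\<le>n. c k = real (Stirling n k)"
  then show "\<forall>x. x ^ n = (\<Sum>k\<le>n. c k * falling_fact x k)"
    using power_eq_sum_Stirling by simp
qed

text \<open>Matrix indices start at 0, so the entry at \<open>(i, j)\<close> is the one in row \<open>i + 1\<close>, column \<open>j + 1\<close>
  in 1-based notation.\<close>

definition Stirling_matrix :: "nat \<Rightarrow> real mat" where
  "Stirling_matrix n =
     mat n n (\<lambda>(i, j). if j \<le> i then real (Stirling (Suc i) (Suc j)) else 0)"

text \<open>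
  \<open>pick I i\<close> is the element number \<open>i\<close> (counting from 0) of \<open>I\<close> in increasing order, which is
  the enumeration that \<open>submatrix\<close> uses. The last premise is thus the entrywise comparison of the
  increasingly ordered row and column indices.
\<close>

definition triangular_totally_positive :: "real mat \<Rightarrow> bool" where
  "triangular_totally_positive A \<longleftrightarrow>
     (\<exists>n. A \<in> carrier_mat n n \<and>
       (\<forall>i<n. \<forall>j<n. i < j \<longrightarrow> A $$ (i, j) = 0) \<and>
       (\<forall>p I J. 1 \<le> p \<longrightarrow> p \<le> n \<longrightarrow> I \<subseteq> {..<n} \<longrightarrow> J \<subseteq> {..<n} \<longrightarrow> card I = p \<longrightarrow> card J = p \<longrightarrow>
          (\<forall>i<p. pick J i \<le> pick I i) \<longrightarrow> 0 < det (submatrix A I J)))"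

end

theory Submission
  imports Defs
begin

text \<open>
  The proof uses only that \<open>M i j = S(i + 1, j + 1)\<close> satisfies a two-term recurrence
  \<open>M (i + 1) j = b j * M i (j - 1) + a j * M i j\<close> whose weights depend on the column alone and
  are positive except for \<open>b 0 = 0\<close>, together with the initial row \<open>(1, 0, 0, \<dots>)\<close>.

  Take a minor with row indices \<open>r 0 < r 1 < \<dots>\<close>, all positive, and column indices
  \<open>c 0 < c 1 < \<dots>\<close>. Since the weights do not depend on the row, the recurrence writes each column
  of the minor as a nonnegative combination of two columns in which all row indices are lowered
  by one: the column to the left and the column itself. Expanding the determinant in all of its
  columns at once (\<open>det_column_sums\<close>) turns the minor into a combination, with nonnegative
  coefficients, of minors of \<open>M\<close> with smaller row indices. Each column index has either moved to
  the left by one or stayed, so the indices are still in weakly increasing order; if two of them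
  coincide, the minor vanishes, and otherwise it is a genuine minor
  (\<open>minor_shift_columns_nonneg\<close>). By induction all minors are nonnegative.

  For strict positivity of a minor with \<open>c s \<le> r s\<close> for all \<open>s\<close>, a single positive summand is
  enough. Moving exactly the columns with \<open>c s = r s\<close> to the left keeps the comparison with the
  lowered row indices, and it produces no coincidence: if \<open>c s + 1 = c (s + 1)\<close> and the column
  \<open>s + 1\<close> moves, then \<open>r s < r (s + 1) = c s + 1\<close>, so the column \<open>s\<close> moves too
  (\<open>shift_diagonal_columns\<close>).

  The induction ends when the first row index is \<open>0\<close>. That row of the minor has at most its
  first entry nonzero, and expansion along it leaves a smaller minor. The two nested inductions,
  on the size of the minor and on its first row index, are in \<open>minor_sign\<close>.
\<close>

section \<open>Minors of an infinite array\<close>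

definition minor :: "(nat \<Rightarrow> nat \<Rightarrow> 'a) \<Rightarrow> nat \<Rightarrow> (nat \<Rightarrow> nat) \<Rightarrow> (nat \<Rightarrow> nat) \<Rightarrow> 'a :: comm_ring_1"
  where "minor M p r c = det (mat p p (\<lambda>(i, j). M (r i) (c j)))"

lemma minor_0 [simp]: "minor M 0 r c = 1"
  by (simp add: minor_def)

lemma minor_eq_0_if_columns_coincide:
  assumes "i < p" "j < p" "i \<noteq> j" "c i = c j"
  shows "minor M p r c = 0"
  unfolding minor_def
proof (rule det_identical_columns)
  show "col (mat p p (\<lambda>(i, j). M (r i) (c j))) i = col (mat p p (\<lambda>(i, j). M (r i) (c j))) j"
    using assms by (intro eq_vecI) auto
qed (use assms in auto)

lemma minor_expand_first_row:
  assumes "\<And>j. 0 < j \<Longrightarrow> j < Suc p \<Longrightarrow> M (r 0) (c j) = 0"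
  shows "minor M (Suc p) r c = M (r 0) (c 0) * minor M p (r \<circ> Suc) (c \<circ> Suc)"
proof -
  let ?A = "mat (Suc p) (Suc p) (\<lambda>(i, j). M (r i) (c j))"
  have "minor M (Suc p) r c = (\<Sum>j<Suc p. ?A $$ (0, j) * cofactor ?A 0 j)"
    unfolding minor_def by (rule laplace_expansion_row) auto
  also have "\<dots> = (\<Sum>j<Suc p. if j = 0 then M (r 0) (c 0) * cofactor ?A 0 0 else 0)"
    by (rule sum.cong) (use assms in auto)
  also have "\<dots> = M (r 0) (c 0) * cofactor ?A 0 0"
    by simp
  also have "mat_delete ?A 0 0 = mat p p (\<lambda>(i, j). M ((r \<circ> Suc) i) ((c \<circ> Suc) j))"
    by (rule eq_matI) (auto simp: mat_delete_def)
  then have "cofactor ?A 0 0 = minor M p (r \<circ> Suc) (c \<circ> Suc)"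
    by (simp add: cofactor_def minor_def)
  finally show ?thesis .
qed

text \<open>
  Multilinearity of the determinant in all columns at once; \<open>X\<close> is the set of columns in which the
  first summand has been chosen.
\<close>

lemma det_column_sums:
  fixes f g :: "nat \<Rightarrow> nat \<Rightarrow> 'a :: comm_ring_1"
  shows "det (mat p p (\<lambda>(i, j). x j * f i j + y j * g i j)) =
    (\<Sum>X\<in>Pow {..<p}. prod x X * prod y ({..<p} - X) *
       det (mat p p (\<lambda>(i, j). if j \<in> X then f i j else g i j)))" (is "?lhs = ?rhs")
proof -
  let ?P = "{\<pi>. \<pi> permutes {0..<p}}"
  let ?h = "\<lambda>X i j. if j \<in> X then f i j else g i j"
  have less: "\<pi> j < p" if "\<pi> \<in> ?P" "j < p" for \<pi> j
    using that permutes_in_image[of \<pi> "{0..<p}" j] by auto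
  have split: "(\<Prod>j<p. x j * f (\<pi> j) j + y j * g (\<pi> j) j) =
      (\<Sum>X\<in>Pow {..<p}. prod x X * prod y ({..<p} - X) * (\<Prod>j<p. ?h X (\<pi> j) j))" for \<pi>
  proof -
    have "(\<Prod>j\<in>X. x j * f (\<pi> j) j) * (\<Prod>j\<in>{..<p} - X. y j * g (\<pi> j) j) =
        prod x X * prod y ({..<p} - X) * (\<Prod>j<p. ?h X (\<pi> j) j)" if X: "X \<in> Pow {..<p}" for X
    proof -
      have "(\<Prod>j<p. ?h X (\<pi> j) j) =
          (\<Prod>j\<in>{..<p} - X. ?h X (\<pi> j) j) * (\<Prod>j\<in>X. ?h X (\<pi> j) j)"
        by (rule prod.subset_diff) (use X in auto)
      then show ?thesis
        by (simp add: prod.distrib mult_ac)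
    qed
    then show ?thesis
      by (simp add: prod_add)
  qed
  have "?lhs = (\<Sum>\<pi>\<in>?P. signof \<pi> * (\<Prod>j<p. x j * f (\<pi> j) j + y j * g (\<pi> j) j))"
    by (subst det_col[of _ p]) (auto intro!: sum.cong prod.cong simp: less)
  also have "\<dots> = (\<Sum>\<pi>\<in>?P. \<Sum>X\<in>Pow {..<p}.
      prod x X * prod y ({..<p} - X) * (signof \<pi> * (\<Prod>j<p. ?h X (\<pi> j) j)))"
    by (simp only: split sum_distrib_left mult_ac)
  also have "\<dots> = (\<Sum>X\<in>Pow {..<p}. prod x X * prod y ({..<p} - X) *
      (\<Sum>\<pi>\<in>?P. signof \<pi> * (\<Prod>j<p. ?h X (\<pi> j) j)))"
    by (subst sum.swap) (simp only: sum_distrib_left)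
  also have "\<dots> = ?rhs"
    by (intro sum.cong refl, subst det_col[of _ p]) (auto intro!: sum.cong prod.cong simp: less)
  finally show ?thesis .
qed

section \<open>Arrays with a positive two-term column recurrence\<close>

definition shift_columns :: "nat set \<Rightarrow> (nat \<Rightarrow> nat) \<Rightarrow> nat \<Rightarrow> nat" where
  "shift_columns X c j = (if j \<in> X then c j - 1 else c j)"

text \<open>
  Setting \<open>b 0 = 0\<close> lets one recurrence cover the leftmost column as well: there \<open>j - 1\<close> truncates
  to \<open>0\<close>, and the zero weight discards the resulting term.
\<close>

locale positive_recurrence =
  fixes M :: "nat \<Rightarrow> nat \<Rightarrow> 'a :: linordered_idom" and a b :: "nat \<Rightarrow> 'a"
  assumes corner_pos: "0 < M 0 0"
    and first_row: "0 < j \<Longrightarrow> M 0 j = 0"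
    and recurrence: "M (Suc i) j = b j * M i (j - 1) + a j * M i j"
    and a_pos: "0 < a j"
    and b_0: "b 0 = 0"
    and b_pos: "0 < j \<Longrightarrow> 0 < b j"
begin

lemma minor_lower_rows:
  "minor M p (\<lambda>i. Suc (r i)) c =
    (\<Sum>X\<in>Pow {..<p}. (\<Prod>j\<in>X. b (c j)) * (\<Prod>j\<in>{..<p} - X. a (c j)) *
       minor M p r (shift_columns X c))"
proof -
  have h: "(\<lambda>(i, j). if j \<in> X then M (r i) (c j - 1) else M (r i) (c j)) =
      (\<lambda>(i, j). M (r i) (shift_columns X c j))" for X
    by (auto simp: shift_columns_def)
  show ?thesis
    unfolding minor_def recurrence
    by (subst det_column_sums) (simp add: h)
qed

lemma coefficient_nonneg: "0 \<le> (\<Prod>j\<in>X. b (c j)) * (\<Prod>j\<in>Y. a (c j))"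
proof -
  have "0 \<le> b j" for j
    using b_pos[of j] b_0 by (cases "j = 0") auto
  then show ?thesis
    using a_pos by (intro mult_nonneg_nonneg prod_nonneg) (auto intro: less_imp_le)
qed

text \<open>
  A shifted column sequence is weakly increasing, because consecutive column indices differ by at
  least one and each decreases by at most one. Hence it either repeats an index or increases
  strictly.
\<close>

lemma minor_shift_columns_nonneg:
  assumes c: "strict_mono_on {..<p} c"
    and nonneg: "\<And>c'. strict_mono_on {..<p} c' \<Longrightarrow> 0 \<le> minor M p r c'"
  shows "0 \<le> minor M p r (shift_columns X c)"
proof (cases "strict_mono_on {..<p} (shift_columns X c)")
  case True
  then show ?thesis by (rule nonneg)
next
  case False
  then obtain i j where ij: "i < p" "j < p" "i < j"
    and ge: "shift_columns X c j \<le> shift_columns X c i"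
    by (auto simp: strict_mono_on_def not_less)
  have "c i < c j"
    using strict_mono_onD[OF c] ij by simp
  then have "shift_columns X c i = shift_columns X c j"
    using ge by (auto simp: shift_columns_def split: if_splits)
  then show ?thesis
    using minor_eq_0_if_columns_coincide[of i p j "shift_columns X c" M r] ij by simp
qed

text \<open>
  The set \<open>X\<close> selects a positive summand. It contains the columns that must move so that their
  indices stay below the lowered row indices, and no others: such a column has positive index, so
  its weight \<open>b\<close> does not vanish.
\<close>

lemma shift_diagonal_columns:
  assumes r: "strict_mono_on {..<p} (\<lambda>i. Suc (r i))" and c: "strict_mono_on {..<p} c"
    and le: "\<And>i. i < p \<Longrightarrow> c i \<le> Suc (r i)"
  defines "X \<equiv> {j \<in> {..<p}. c j = Suc (r j)}"
  shows "strict_mono_on {..<p} (shift_columns X c)"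
    and "\<And>i. i < p \<Longrightarrow> shift_columns X c i \<le> r i"
    and "0 < (\<Prod>j\<in>X. b (c j)) * (\<Prod>j\<in>{..<p} - X. a (c j))"
proof -
  show "strict_mono_on {..<p} (shift_columns X c)"
  proof (rule strict_mono_onI)
    fix i j assume ij: "i \<in> {..<p}" "j \<in> {..<p}" "i < j"
    have "c i < c j" "r i < r j"
      using strict_mono_onD[OF c ij] strict_mono_onD[OF r ij] by auto
    then show "shift_columns X c i < shift_columns X c j"
      using le[of i] ij by (auto simp: shift_columns_def X_def)
  qed
  show "shift_columns X c i \<le> r i" if "i < p" for i
    using le[OF that] that by (auto simp: shift_columns_def X_def)
  show "0 < (\<Prod>j\<in>X. b (c j)) * (\<Prod>j\<in>{..<p} - X. a (c j))"
    by (intro mult_pos_pos prod_pos) (auto simp: X_def a_pos b_pos)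
qed

text \<open>
  Nonnegativity for all column sets is proved along with positivity, since the other summands of
  the expansion need not satisfy the comparison of indices.
\<close>

lemma minor_sign:
  assumes "strict_mono_on {..<p} r" "strict_mono_on {..<p} c"
  shows "0 \<le> minor M p r c \<and> ((\<forall>i<p. c i \<le> r i) \<longrightarrow> 0 < minor M p r c)"
  using assms
proof (induction p arbitrary: r c)
  case 0
  then show ?case by simp
next
  case (Suc p)
  have "0 \<le> minor M (Suc p) r c \<and> ((\<forall>i<Suc p. c i \<le> r i) \<longrightarrow> 0 < minor M (Suc p) r c)"
    if "r 0 = k" "strict_mono_on {..<Suc p} r" "strict_mono_on {..<Suc p} c" for k
    using that
  proof (induction k arbitrary: r c)
    case 0
    have tails: "strict_mono_on {..<p} (r \<circ> Suc)" "strict_mono_on {..<p} (c \<circ> Suc)"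
      using 0 by (auto simp: strict_mono_on_def)
    have "M (r 0) (c j) = 0" if "0 < j" "j < Suc p" for j
      using strict_mono_onD[OF 0(3), of 0 j] that 0(1) by (simp add: first_row)
    then have eq: "minor M (Suc p) r c = M 0 (c 0) * minor M p (r \<circ> Suc) (c \<circ> Suc)"
      using 0(1) by (subst minor_expand_first_row) auto
    have "0 \<le> M 0 (c 0)"
      using corner_pos first_row[of "c 0"] by (cases "c 0 = 0") auto
    moreover have "0 < M 0 (c 0)" if "\<forall>i<Suc p. c i \<le> r i"
      using that 0(1) corner_pos by auto
    ultimately show ?case
      using Suc.IH[OF tails] unfolding eq
      by (intro conjI impI mult_nonneg_nonneg mult_pos_pos) (simp_all add: o_def)
  next
    case (Suc k)
    let ?r = "\<lambda>i. r i - 1"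
    have r_Suc: "Suc (?r i) = r i" if "i < Suc p" for i
      using strict_mono_onD[OF Suc.prems(2), of 0 i] Suc.prems(1) that by (cases "i = 0") auto
    have r: "strict_mono_on {..<Suc p} ?r"
    proof (rule strict_mono_onI)
      fix i j assume ij: "i \<in> {..<Suc p}" "j \<in> {..<Suc p}" "i < j"
      then show "?r i < ?r j"
        using strict_mono_onD[OF Suc.prems(2) ij] r_Suc[of i] by simp
    qed
    have r0: "?r 0 = k"
      using Suc.prems(1) by simp
    note IH = Suc.IH[OF r0 r]
    let ?t = "\<lambda>X. (\<Prod>j\<in>X. b (c j)) * (\<Prod>j\<in>{..<Suc p} - X. a (c j)) *
       minor M (Suc p) ?r (shift_columns X c)"
    have "minor M (Suc p) r c = minor M (Suc p) (\<lambda>i. Suc (?r i)) c"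
      unfolding minor_def using r_Suc by (intro arg_cong[of _ _ det] eq_matI) auto
    then have eq: "minor M (Suc p) r c = (\<Sum>X\<in>Pow {..<Suc p}. ?t X)"
      by (simp only: minor_lower_rows)
    have nonneg: "0 \<le> ?t X" for X
      using IH Suc.prems(3)
      by (intro mult_nonneg_nonneg[OF coefficient_nonneg] minor_shift_columns_nonneg) auto
    moreover have "0 < (\<Sum>X\<in>Pow {..<Suc p}. ?t X)" if le: "\<forall>i<Suc p. c i \<le> r i"
    proof -
      let ?X = "{j \<in> {..<Suc p}. c j = Suc (?r j)}"
      have r': "strict_mono_on {..<Suc p} (\<lambda>i. Suc (?r i))"
        using r by (auto simp: strict_mono_on_def)
      have le': "c i \<le> Suc (?r i)" if "i < Suc p" for i
        using le r_Suc that by simp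
      note X = shift_diagonal_columns[OF r' Suc.prems(3) le']
      have "0 < minor M (Suc p) ?r (shift_columns ?X c)"
        using IH[OF X(1)] X(2) by blast
      then have "0 < ?t ?X"
        by (intro mult_pos_pos[OF X(3)])
      then show ?thesis
        using nonneg by (intro sum_pos2[of _ ?X]) auto
    qed
    ultimately show ?case
      unfolding eq by (auto intro: sum_nonneg)
  qed
  from this[OF refl Suc.prems] show ?case .
qed

end

section \<open>The Stirling matrix\<close>

text \<open>
  The index shift removes row and column \<open>0\<close> of the Stirling numbers, where the weight \<open>k\<close> of the
  recurrence vanishes; afterwards it is \<open>j + 1\<close> and positive throughout.
\<close>

interpretation Stirling: positive_recurrence
  "\<lambda>i j. real (Stirling (Suc i) (Suc j))" "\<lambda>j. real (Suc j)" "\<lambda>j. if j = 0 then 0 else 1"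
proof
  fix i j :: nat
  show "real (Stirling (Suc (Suc i)) (Suc j)) =
      (if j = 0 then 0 else 1) * real (Stirling (Suc i) (Suc (j - 1))) +
      real (Suc j) * real (Stirling (Suc i) (Suc j))"
    by (cases j) (simp_all add: algebra_simps)
qed auto

lemma submatrix_Stirling_matrix:
  assumes "I \<subseteq> {..<n}" "J \<subseteq> {..<n}" "card I = p" "card J = p"
  shows "submatrix (Stirling_matrix n) I J =
    mat p p (\<lambda>(i, j). real (Stirling (Suc (pick I i)) (Suc (pick J j))))"
proof -
  have "{i. i < n \<and> i \<in> I} = I" "{i. i < n \<and> i \<in> J} = J"
    using assms by auto
  moreover have "pick I i < n" "pick J i < n" if "i < p" for i
    using pick_in_set_le[of i I] pick_in_set_le[of i J] that assms by auto
  ultimately show ?thesis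
    using assms by (intro eq_matI) (auto simp: submatrix_def Stirling_matrix_def)
qed

theorem proposition3p3:
  fixes n :: nat
  assumes "n \<ge> 1"
  shows "triangular_totally_positive (Stirling_matrix n)"
  unfolding triangular_totally_positive_def
proof (intro exI[of _ n] conjI allI impI)
  fix p I J
  assume sub: "I \<subseteq> {..<n}" "J \<subseteq> {..<n}" and card: "card I = p" "card J = p"
    and le: "\<forall>i<p. pick J i \<le> pick I i"
  have "strict_mono_on {..<p} (pick I)" "strict_mono_on {..<p} (pick J)"
    using card by (auto intro!: strict_mono_onI pick_mono_le)
  then show "0 < det (submatrix (Stirling_matrix n) I J)"
    using Stirling.minor_sign le
    by (simp add: submatrix_Stirling_matrix[OF sub card] minor_def)
qed (auto simp: Stirling_matrix_def)

end
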